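(* Let $(\Omega,\mathrm{pr})$ be a probability scheme, and let $\mathcal{B}\subseteq\mathcal{A}$ be unital $\mathbb{R}$-subalgebras of $\mathbb{R}^{\Omega}$. Then for all $X_1,X_2\in\mathbb{R}^{\Omega}$, $$\mathrm{cov}_{\mathcal{B}}(X_1,X_2)=\mathrm{E}_{\mathcal{B}}\,\mathrm{cov}_{\mathcal{A}}(X_1,X_2)+\mathrm{cov}_{\mathcal{B}}(\mathrm{E}_{\mathcal{A}}X_1,\mathrm{E}_{\mathcal{A}}X_2).$$ In particular, for all $X\in\mathbb{R}^{\Omega}$, $\mathrm{var}_{\mathcal{B}}X=\mathrm{E}_{\mathcal{B}}\mathrm{var}_{\mathcal{A}}X+\mathrm{var}_{\mathcal{B}}\mathrm{E}_{\mathcal{A}}X$.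
   Context: A (probability) scheme is a finite set $\Omega$ with a function $\mathrm{pr}\colon\Omega\to(0,\infty)$ such that $\sum_{\omega}\mathrm{pr}(\omega)=1$. $\mathbb{R}^{\Omega}$ is the real algebra of functions $\Omega\to\mathbb{R}$ under pointwise operations. For a unital $\mathbb{R}$-subalgebra $\mathcal{A}\subseteq\mathbb{R}^{\Omega}$, the atoms of $\mathcal{A}$ are the equivalence classes of the relation $\omega_1\equiv_{\mathcal{A}}\omega_2\iff X(\omega_1)=X(\omega_2)$ for all $X\in\mathcal{A}$. The conditional expectation relative to $\mathcal{A}$ is $\mathrm{E}_{\mathcal{A}}X=\sum_{A}\mathrm{E}(X|A)1_A$, the sum over atoms $A$, where $\mathrm{E}(X|A)=\frac{1}{\Pr(A)}\sum_{\omega\in A}X(\omega)\mathrm{pr}(\omega)$ and $\Pr(A)=\sum_{\omega\in A}\mathrm{pr}(\omega)$. The relative covariance is $\mathrm{cov}_{\mathcal{A}}(X,Y)=\mathrm{E}_{\mathcal{A}}\bigl((X-\mathrm{E}_{\mathcal{A}}X)(Y-\mathrm{E}_{\mathcal{A}}Y)\bigr)$, and $\mathrm{var}_{\mathcal{A}}X=\mathrm{cov}_{\mathcal{A}}(X,X)$. *)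

theory Defs
  imports Complex_Main "HOL-Library.Function_Algebras" "HOL-Library.Indicator_Function"
begin

text \<open>
  The finite set \<open>\<Omega>\<close> is the universe of a type \<open>'a\<close> of class \<open>finite\<close>, so that
  \<open>'a \<Rightarrow> real\<close> is the algebra of all real functions on \<open>\<Omega>\<close>. Its pointwise \<open>+\<close>, \<open>-\<close>, \<open>*\<close> and \<open>1\<close>
  come from \<open>HOL-Library.Function_Algebras\<close>; scalar multiplication is written out.
\<close>

definition probability_scheme :: "('a::finite \<Rightarrow> real) \<Rightarrow> bool" where
  "probability_scheme pr \<longleftrightarrow> (\<forall>\<omega>. 0 < pr \<omega>) \<and> (\<Sum>\<omega>\<in>UNIV. pr \<omega>) = 1"

definition unital_subalgebra :: "('a::finite \<Rightarrow> real) set \<Rightarrow> bool" where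
  "unital_subalgebra \<A> \<longleftrightarrow>
     1 \<in> \<A> \<and>
     (\<forall>X\<in>\<A>. \<forall>Y\<in>\<A>. X + Y \<in> \<A>) \<and>
     (\<forall>X\<in>\<A>. \<forall>Y\<in>\<A>. X * Y \<in> \<A>) \<and>
     (\<forall>c. \<forall>X\<in>\<A>. (\<lambda>\<omega>. c * X \<omega>) \<in> \<A>)"

definition alg_equiv :: "('a::finite \<Rightarrow> real) set \<Rightarrow> ('a \<times> 'a) set" where
  "alg_equiv \<A> = {(\<omega>1, \<omega>2). \<forall>X\<in>\<A>. X \<omega>1 = X \<omega>2}"

definition atoms :: "('a::finite \<Rightarrow> real) set \<Rightarrow> 'a set set" where
  "atoms \<A> = UNIV // alg_equiv \<A>"

definition Pr :: "('a::finite \<Rightarrow> real) \<Rightarrow> 'a set \<Rightarrow> real" where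
  "Pr pr A = (\<Sum>\<omega>\<in>A. pr \<omega>)"

definition event_exp :: "('a::finite \<Rightarrow> real) \<Rightarrow> ('a \<Rightarrow> real) \<Rightarrow> 'a set \<Rightarrow> real" where
  "event_exp pr X A = 1 / Pr pr A * (\<Sum>\<omega>\<in>A. X \<omega> * pr \<omega>)"

definition cond_exp :: "('a::finite \<Rightarrow> real) \<Rightarrow> ('a \<Rightarrow> real) set \<Rightarrow> ('a \<Rightarrow> real) \<Rightarrow> ('a \<Rightarrow> real)" where
  "cond_exp pr \<A> X = (\<lambda>\<omega>. \<Sum>A\<in>atoms \<A>. event_exp pr X A * indicator A \<omega>)"

definition rel_cov ::
  "('a::finite \<Rightarrow> real) \<Rightarrow> ('a \<Rightarrow> real) set \<Rightarrow> ('a \<Rightarrow> real) \<Rightarrow> ('a \<Rightarrow> real) \<Rightarrow> ('a \<Rightarrow> real)" where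
  "rel_cov pr \<A> X Y = cond_exp pr \<A> ((X - cond_exp pr \<A> X) * (Y - cond_exp pr \<A> Y))"

definition rel_var :: "('a::finite \<Rightarrow> real) \<Rightarrow> ('a \<Rightarrow> real) set \<Rightarrow> ('a \<Rightarrow> real) \<Rightarrow> ('a \<Rightarrow> real)" where
  "rel_var pr \<A> X = rel_cov pr \<A> X X"

end

theory Submission
  imports Defs
begin

text \<open>
  Conditional expectation relative to \<open>\<A>\<close> is linear, treats functions constant on the atoms of \<open>\<A>\<close>
  as scalars, and satisfies \<open>E\<^sub>\<B> \<circ> E\<^sub>\<A> = E\<^sub>\<B>\<close> for \<open>\<B> \<subseteq> \<A>\<close>. The first two properties give
  \<open>cov\<^sub>\<A>(X, Y) = E\<^sub>\<A>(X Y) - E\<^sub>\<A> X E\<^sub>\<A> Y\<close>, and with the third the right-hand side telescopes.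
\<close>

lemma equiv_alg_equiv: "equiv UNIV (alg_equiv \<A>)"
  by (auto simp: alg_equiv_def equiv_def refl_on_def sym_def trans_def)

lemma alg_equiv_antimono: "\<B> \<subseteq> \<A> \<Longrightarrow> alg_equiv \<A> \<subseteq> alg_equiv \<B>"
  by (auto simp: alg_equiv_def)

lemma alg_equiv_sym: "(x, y) \<in> alg_equiv \<A> \<Longrightarrow> (y, x) \<in> alg_equiv \<A>"
  by (auto simp: alg_equiv_def)

lemma alg_equiv_trans:
  "(x, y) \<in> alg_equiv \<A> \<Longrightarrow> (y, z) \<in> alg_equiv \<A> \<Longrightarrow> (x, z) \<in> alg_equiv \<A>"
  by (auto simp: alg_equiv_def)

lemma alg_equiv_class_eq:
  "(x, y) \<in> alg_equiv \<A> \<Longrightarrow> alg_equiv \<A> `` {x} = alg_equiv \<A> `` {y}"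
  by (rule equiv_class_eq[OF equiv_alg_equiv])

text \<open>Atoms are disjoint, so only the indicator of the class of \<omega> survives at \<omega>.
  All later arguments use this pointwise form instead of the sum over atoms.\<close>

lemma cond_exp_eq_event_exp: "cond_exp pr \<A> X \<omega> = event_exp pr X (alg_equiv \<A> `` {\<omega>})"
proof -
  let ?C = "alg_equiv \<A> `` {\<omega>}"
  have C: "?C \<in> atoms \<A>"
    unfolding atoms_def by (rule quotientI) simp
  have "\<omega> \<notin> A" if "A \<in> atoms \<A>" "A \<noteq> ?C" for A
    using that unfolding atoms_def by (auto elim!: quotientE dest: alg_equiv_class_eq)
  then have "(\<Sum>A\<in>atoms \<A>. event_exp pr X A * indicator A \<omega>)
      = (\<Sum>A\<in>{?C}. event_exp pr X A * indicator A \<omega>)"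
    using C by (intro sum.mono_neutral_right) auto
  also have "\<dots> = event_exp pr X ?C"
    by (simp add: alg_equiv_def)
  finally show ?thesis
    by (simp add: cond_exp_def)
qed

lemma cond_exp_cong_alg_equiv:
  "(x, y) \<in> alg_equiv \<A> \<Longrightarrow> cond_exp pr \<A> X x = cond_exp pr \<A> X y"
  by (simp only: cond_exp_eq_event_exp alg_equiv_class_eq[of x y])

lemma cond_exp_add: "cond_exp pr \<A> (X + Y) = cond_exp pr \<A> X + cond_exp pr \<A> Y"
  by (rule ext)
    (simp add: cond_exp_eq_event_exp event_exp_def distrib_right sum.distrib add_divide_distrib)

lemma cond_exp_diff: "cond_exp pr \<A> (X - Y) = cond_exp pr \<A> X - cond_exp pr \<A> Y"
  by (rule ext)
    (simp add: cond_exp_eq_event_exp event_exp_def left_diff_distrib sum_subtractf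
      diff_divide_distrib)

text \<open>The factor \<open>Y\<close> leaves the sum over each class. Asking for constancy on
  classes lets \<open>cond_exp_cong_alg_equiv\<close> supply the premise when \<open>Y\<close> is
  itself a conditional expectation.\<close>

lemma cond_exp_mult_right:
  assumes "\<And>x y. (x, y) \<in> alg_equiv \<A> \<Longrightarrow> Y x = Y y"
  shows "cond_exp pr \<A> (X * Y) = cond_exp pr \<A> X * Y"
proof (rule ext)
  fix \<omega>
  have "(\<Sum>x\<in>alg_equiv \<A> `` {\<omega>}. (X * Y) x * pr x)
      = (\<Sum>x\<in>alg_equiv \<A> `` {\<omega>}. X x * pr x * Y \<omega>)"
    by (rule sum.cong) (auto dest: assms)
  then show "cond_exp pr \<A> (X * Y) \<omega> = (cond_exp pr \<A> X * Y) \<omega>"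
    by (simp add: cond_exp_eq_event_exp event_exp_def sum_distrib_right)
qed

lemma Pr_atom_pos:
  assumes "\<And>\<omega>. 0 < pr \<omega>"
  shows "0 < Pr pr (alg_equiv \<A> `` {\<omega>})"
  unfolding Pr_def by (rule sum_pos) (use assms in \<open>auto simp: alg_equiv_def\<close>)

text \<open>Here \<open>C\<close> is a union of atoms. Averaging spreads the mass
  \<open>X y * pr y\<close> over the atom of \<open>y\<close> in proportions
  \<open>pr x / Pr pr (?c x)\<close>, which add up to 1; exchanging the double sum collects these
  shares.\<close>

lemma sum_cond_exp:
  assumes pos: "\<And>\<omega>. 0 < pr \<omega>"
    and closed: "\<And>x y. (x, y) \<in> alg_equiv \<A> \<Longrightarrow> x \<in> C \<Longrightarrow> y \<in> C"
  shows "(\<Sum>x\<in>C. cond_exp pr \<A> X x * pr x) = (\<Sum>x\<in>C. X x * pr x)"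
proof -
  let ?c = "\<lambda>x. alg_equiv \<A> `` {x}"
  \<comment> \<open>Writing classes as restrictions of \<open>C\<close> gives the shape that
    \<open>sum.swap_restrict\<close> expects.\<close>
  have class_eq: "?c x = {y \<in> C. (x, y) \<in> alg_equiv \<A>}" if "x \<in> C" for x
    using closed that by auto
  have "(\<Sum>x\<in>C. cond_exp pr \<A> X x * pr x)
      = (\<Sum>x\<in>C. \<Sum>y\<in>{y \<in> C. (x, y) \<in> alg_equiv \<A>}. X y * pr y * pr x / Pr pr (?c x))"
  proof (rule sum.cong[OF refl])
    fix x
    assume "x \<in> C"
    then show "cond_exp pr \<A> X x * pr x =
        (\<Sum>y\<in>{y \<in> C. (x, y) \<in> alg_equiv \<A>}. X y * pr y * pr x / Pr pr (?c x))"
      unfolding class_eq[OF \<open>x \<in> C\<close>, symmetric]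
      by (simp add: cond_exp_eq_event_exp event_exp_def sum_distrib_right sum_divide_distrib)
  qed
  also have "\<dots> = (\<Sum>y\<in>C. \<Sum>x\<in>{x \<in> C. (x, y) \<in> alg_equiv \<A>}. X y * pr y * pr x / Pr pr (?c x))"
    by (rule sum.swap_restrict) simp_all
  \<comment> \<open>By symmetry \<open>x\<close> now runs over the class of \<open>y\<close>, so the
    denominator no longer depends on \<open>x\<close>.\<close>
  also have "\<dots> = (\<Sum>y\<in>C. \<Sum>x\<in>?c y. X y * pr y / Pr pr (?c y) * pr x)"
  proof (intro sum.cong refl)
    fix y
    assume "y \<in> C"
    then show "{x \<in> C. (x, y) \<in> alg_equiv \<A>} = ?c y"
      by (blast intro: closed alg_equiv_sym)
  next
    fix x y
    assume "x \<in> ?c y"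
    then have "?c x = ?c y"
      by (simp add: alg_equiv_class_eq[of y x])
    then show "X y * pr y * pr x / Pr pr (?c x) = X y * pr y / Pr pr (?c y) * pr x"
      by simp
  qed
  also have "\<dots> = (\<Sum>y\<in>C. X y * pr y)"
  proof (rule sum.cong[OF refl])
    fix y
    have "Pr pr (?c y) \<noteq> 0"
      using Pr_atom_pos[of pr \<A> y, OF pos] by simp
    then show "(\<Sum>x\<in>?c y. X y * pr y / Pr pr (?c y) * pr x) = X y * pr y"
      unfolding sum_distrib_left[symmetric] Pr_def[symmetric] by simp
  qed
  finally show ?thesis .
qed

text \<open>Fewer functions separate fewer points, so each class of \<B> is a union of classes of
  \<A>, and \<open>sum_cond_exp\<close> applies with that class as \<open>C\<close>.\<close>

lemma cond_exp_tower:
  assumes "\<And>\<omega>. 0 < pr \<omega>" and "\<B> \<subseteq> \<A>"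
  shows "cond_exp pr \<B> (cond_exp pr \<A> X) = cond_exp pr \<B> X"
proof (rule ext)
  fix \<omega>
  have "(\<Sum>x\<in>alg_equiv \<B> `` {\<omega>}. cond_exp pr \<A> X x * pr x)
      = (\<Sum>x\<in>alg_equiv \<B> `` {\<omega>}. X x * pr x)"
    using assms(1)
  proof (rule sum_cond_exp)
    fix x y
    assume "(x, y) \<in> alg_equiv \<A>" and "x \<in> alg_equiv \<B> `` {\<omega>}"
    then show "y \<in> alg_equiv \<B> `` {\<omega>}"
      using alg_equiv_antimono[OF assms(2)] by (auto intro: alg_equiv_trans)
  qed
  then show "cond_exp pr \<B> (cond_exp pr \<A> X) \<omega> = cond_exp pr \<B> X \<omega>"
    by (simp add: cond_exp_eq_event_exp[of _ \<B>] event_exp_def)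
qed

lemma rel_cov_eq:
  assumes pos: "\<And>\<omega>. 0 < pr \<omega>"
  shows "rel_cov pr \<A> X Y = cond_exp pr \<A> (X * Y) - cond_exp pr \<A> X * cond_exp pr \<A> Y"
proof -
  let ?E = "cond_exp pr \<A>"
  have pull_out: "?E (U * ?E V) = ?E U * ?E V" for U V
    by (rule cond_exp_mult_right) (rule cond_exp_cong_alg_equiv)
  \<comment> \<open>Each product after \<open>X * Y\<close> has a conditional expectation as right
    factor, ready for \<open>pull_out\<close>.\<close>
  have "(X - ?E X) * (Y - ?E Y) = X * Y - X * ?E Y - Y * ?E X + ?E X * ?E Y"
    by (rule ext) (simp add: algebra_simps)
  then have "rel_cov pr \<A> X Y
      = ?E (X * Y) - ?E X * ?E Y - ?E Y * ?E X + ?E (?E X) * ?E Y"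
    by (simp only: rel_cov_def cond_exp_add cond_exp_diff pull_out)
  \<comment> \<open>Idempotence is the tower property with both algebras equal to \<A>.\<close>
  also have "?E (?E X) = ?E X"
    using pos by (rule cond_exp_tower) simp
  finally show ?thesis
    by (simp only: mult.commute[of "?E Y"] diff_add_cancel)
qed

text \<open>After expanding all three covariances, the term
  \<open>cond_exp pr \<B> (cond_exp pr \<A> X * cond_exp pr \<A> Y)\<close> occurs with both signs
  and cancels.\<close>

lemma rel_cov_total:
  assumes pos: "\<And>\<omega>. 0 < pr \<omega>" and sub: "\<B> \<subseteq> \<A>"
  shows "rel_cov pr \<B> X Y =
    cond_exp pr \<B> (rel_cov pr \<A> X Y) + rel_cov pr \<B> (cond_exp pr \<A> X) (cond_exp pr \<A> Y)"
  by (simp only: rel_cov_eq[of pr, OF pos] cond_exp_diff cond_exp_tower[of pr, OF pos sub]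
      add_diff_eq diff_add_cancel)

theorem mainTheorem9:
  fixes pr :: "'a::finite \<Rightarrow> real"
    and \<A> \<B> :: "('a \<Rightarrow> real) set"
  assumes "probability_scheme pr"
    and "unital_subalgebra \<A>"
    and "unital_subalgebra \<B>"
    and "\<B> \<subseteq> \<A>"
  shows "(\<forall>X\<^sub>1 X\<^sub>2. rel_cov pr \<B> X\<^sub>1 X\<^sub>2 =
            cond_exp pr \<B> (rel_cov pr \<A> X\<^sub>1 X\<^sub>2) +
            rel_cov pr \<B> (cond_exp pr \<A> X\<^sub>1) (cond_exp pr \<A> X\<^sub>2)) \<and>
         (\<forall>X. rel_var pr \<B> X =
            cond_exp pr \<B> (rel_var pr \<A> X) + rel_var pr \<B> (cond_exp pr \<A> X))"
proof -
  have pos: "\<And>\<omega>. 0 < pr \<omega>"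
    using assms(1) by (simp add: probability_scheme_def)
  show ?thesis
    unfolding rel_var_def by (intro conjI allI rel_cov_total pos assms(4))
qed

end
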